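(* Let $B_1=B_1(0)\subset\mathbb{R}^n$ be the open unit ball. Let $\psi\in C^1(B_1)$ be concave and satisfy $\psi\ge(n-2)\frac{\pi}{2}$ on $B_1$. Let $u\in C^3(\overline{B_1})$ be a solution of $$\sum_{i=1}^n\arctan\lambda_i(x)=\psi(x),\qquad x\in B_1,$$ where $\lambda_1(x),\dots,\lambda_n(x)$ are the eigenvalues of the Hessian $D^2u(x)$. Then $$|Du(0)|\le C(n)\left(1+\operatorname{osc}_{B_1}u\right),$$ where the constant $C(n)$ depends only on $n$ (in particular, not on $\psi$).
   Context: $\operatorname{osc}_{B_1}u=\sup_{B_1}u-\inf_{B_1}u$. *)

theory Defs
  imports "HOL-Analysis.Analysis" "HOL-Computational_Algebra.Computational_Algebra"
begin

definition partial_deriv :: "'n::finite \<Rightarrow> (real^'n \<Rightarrow> real) \<Rightarrow> real^'n \<Rightarrow> real" where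
  "partial_deriv i f x = frechet_derivative f (at x) (axis i 1)"

primrec iter_partial :: "'n::finite list \<Rightarrow> (real^'n \<Rightarrow> real) \<Rightarrow> real^'n \<Rightarrow> real" where
  "iter_partial [] f = f"
| "iter_partial (i # is) f = partial_deriv i (iter_partial is f)"

(* Intended for open S: derivatives are taken with respect to full neighbourhoods. *)
definition C_k_on :: "nat \<Rightarrow> (real^'n::finite) set \<Rightarrow> (real^'n \<Rightarrow> real) \<Rightarrow> bool" where
  "C_k_on k S f \<longleftrightarrow>
     (\<forall>is. length is < k \<longrightarrow> (\<forall>x\<in>S. iter_partial is f differentiable (at x))) \<and>
     (\<forall>is. length is \<le> k \<longrightarrow> continuous_on S (iter_partial is f))"

(* The space usually written C^k of the closure of the open set S: functions in C^k(S) all of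
   whose derivatives of order at most k extend continuously to the closure of S.  Values of f
   outside S are irrelevant. *)
definition C_k_closure :: "nat \<Rightarrow> (real^'n::finite) set \<Rightarrow> (real^'n \<Rightarrow> real) \<Rightarrow> bool" where
  "C_k_closure k S f \<longleftrightarrow> C_k_on k S f \<and>
     (\<forall>is. length is \<le> k \<longrightarrow>
        (\<exists>g. continuous_on (closure S) g \<and> (\<forall>x\<in>S. g x = iter_partial is f x)))"

definition gradient :: "(real^'n::finite \<Rightarrow> real) \<Rightarrow> real^'n \<Rightarrow> real^'n" where
  "gradient f x = (\<chi> i. partial_deriv i f x)"

definition hessian :: "(real^'n::finite \<Rightarrow> real) \<Rightarrow> real^'n \<Rightarrow> real^'n^'n" where
  "hessian f x = (\<chi> i j. partial_deriv i (partial_deriv j f) x)"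

definition charpoly :: "real^'n^'n::finite \<Rightarrow> real poly" where
  "charpoly A = det (\<chi> i j. (if i = j then [:0, 1:] else 0) - [:A $ i $ j:])"

(* Real eigenvalues with multiplicity; a symmetric matrix has exactly CARD('n) of them. *)
definition eigenvalues :: "real^'n^'n::finite \<Rightarrow> real multiset" where
  "eigenvalues A = proots (charpoly A)"

lemma poly_det: "poly (det M) t = det (\<chi> i j. poly (M $ i $ j) t)"
  for M :: "real poly^'n^'n::finite"
  by (simp add: det_def poly_sum poly_prod sign_def)

lemma charpoly_eq: "poly (charpoly A) t = det (mat t - A)"
  unfolding charpoly_def poly_det
  by (rule arg_cong[of _ _ det]) (simp add: vec_eq_iff mat_def)

definition osc_on :: "'a set \<Rightarrow> ('a \<Rightarrow> real) \<Rightarrow> real" where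
  "osc_on S f = (SUP x\<in>S. f x) - (INF x\<in>S. f x)"

end

theory Submission
  imports Defs
begin

text \<open>
  The estimate is proved by doubling the variables and using only second-order conditions at a maximum;
  the equation is never differentiated. Let \<open>M\<close> be the oscillation of \<open>u\<close> and consider

    \<open>\<Phi>(x, y) = u(x) - u(y) - (L |x - y| - b |x - y|\<^sup>2 / 2) - 4 M |x|\<^sup>2\<close>

  for \<open>|x| \<le> 1/2\<close> and \<open>|x - y| \<le> 1/4\<close>, with \<open>b = 2 n + 16 M\<close> and \<open>L = 4 M + b / 8\<close>. If \<open>\<Phi> \<le> 0\<close>, then
  setting \<open>x = 0\<close> gives \<open>u(0) - u(y) \<le> L |y|\<close>, hence \<open>|Du(0)| \<le> L = 6 M + n / 4\<close>.

  Suppose that \<open>\<Phi>\<close> has a positive maximum. By the choice of the constants it is attained at an interior point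
  \<open>(x, y)\<close> with \<open>x \<noteq> y\<close>. Let \<open>e\<close> be the direction of \<open>x - y\<close>. Because the radial penalty is strictly concave,
  the second variation (\<open>doubling_second_variation\<close>) forces \<open>D\<^sup>2u(x)\<close> to be very negative in direction \<open>e\<close>.
  In the critical phase any two eigenvalues have nonnegative sum (\<open>critical_phase_dominates\<close>), so
  \<open>D\<^sup>2u(x)\<close> has one very negative eigenvalue and all others are at least as large in absolute value and
  positive. Inserting this in the second variation inequality shows that every eigenvalue of \<open>D\<^sup>2u(y)\<close> is
  large and positive (\<open>doubling_phase_gap\<close>).

  The excess \<open>w = \<psi> - (n - 2) \<pi> / 2\<close> is therefore small at \<open>x\<close>, namely at most \<open>1/2\<close>, and
  nearly maximal at \<open>y\<close>, namely at least \<open>\<pi> - 1\<close>. But \<open>w\<close> is concave and nonnegative, and \<open>x\<close> is the midpoint of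
  \<open>y\<close> and \<open>2 x - y\<close>, so \<open>w(x) \<ge> w(y) / 2\<close>. This contradicts \<open>\<pi> > 2\<close> (\<open>doubling_estimate\<close>).
\<close>

(* The coefficient notation of power series would make every vector component ambiguous. *)
no_notation fps_nth (infixl "$" 75)

section \<open>Spectral theorem for symmetric matrices\<close>

text \<open>
  A maximiser \<open>v\<close> of the quadratic form on the unit sphere of \<open>S\<close> is an eigenvector: moving from \<open>v\<close> in
  the direction of the residual \<open>r = f v - c v\<close> would otherwise increase the Rayleigh quotient to first
  order.
\<close>
lemma selfadjoint_eigenvector_in_subspace:
  fixes f :: "'a::euclidean_space \<Rightarrow> 'a"
  assumes f: "linear f" and sa: "\<And>x y. f x \<bullet> y = x \<bullet> f y"
    and S: "subspace S" "f ` S \<subseteq> S" "S \<noteq> {0}"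
  obtains v c where "v \<in> S" "norm v = 1" "f v = c *\<^sub>R v"
proof -
  interpret linear f by fact
  let ?K = "S \<inter> sphere 0 1"
  obtain z where z: "z \<in> S" "z \<noteq> 0" using S subspace_0 by blast
  have ne: "(1 / norm z) *\<^sub>R z \<in> ?K"
    using z S by (auto simp: subspace_scale)
  have "compact ?K"
    by (metis closed_subspace S(1) compact_sphere closed_Int_compact)
  moreover have "continuous_on ?K (\<lambda>x. f x \<bullet> x)"
    by (intro continuous_intros linear_continuous_on linear_linear[THEN iffD2] f)
  ultimately obtain v where "v \<in> ?K" and max: "\<And>x. x \<in> ?K \<Longrightarrow> f x \<bullet> x \<le> f v \<bullet> v"
    using continuous_attains_sup[of ?K "\<lambda>x. f x \<bullet> x"] ne by blast
  then have v: "v \<in> S" "norm v = 1" by auto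
  define c where "c = f v \<bullet> v"
  have le: "f x \<bullet> x \<le> c * (x \<bullet> x)" if "x \<in> S" for x
  proof (cases "x = 0")
    case False
    have "f ((1 / norm x) *\<^sub>R x) \<bullet> ((1 / norm x) *\<^sub>R x) \<le> c"
      unfolding c_def by (rule max) (use False that S in \<open>auto simp: subspace_scale\<close>)
    then have "(f x \<bullet> x) / (norm x)^2 \<le> c"
      by (simp add: scale power2_eq_square)
    then show ?thesis
      using False by (simp add: divide_simps power2_norm_eq_inner mult.commute)
  qed (simp add: zero)
  define r where "r = f v - c *\<^sub>R v"
  have rS: "r \<in> S" unfolding r_def using v S by (auto intro!: subspace_diff subspace_scale)
  have vv: "v \<bullet> v = 1" using v by (simp add: norm_eq_1)
  have "r = 0"
  proof (rule ccontr)
    assume "r \<noteq> 0"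
    then have rr: "r \<bullet> r > 0" by simp
    \<comment> \<open>Maximality along \<open>v + s r\<close> bounds the linear term in \<open>s\<close> by the quadratic one; the step
      \<open>s = |r|\<^sup>2 / q\<close> then violates it.\<close>
    define q where "q = c * (r \<bullet> r) - f r \<bullet> r"
    have fvr: "f v \<bullet> r = r \<bullet> r + c * (v \<bullet> r)"
      by (simp add: r_def algebra_simps)
    have frv: "f r \<bullet> v = f v \<bullet> r" using sa[of r v] by (simp add: inner_commute)
    have key: "2 * s * (r \<bullet> r) \<le> s^2 * q" for s :: real
    proof -
      have "v + s *\<^sub>R r \<in> S" using v rS S by (auto intro!: subspace_add subspace_scale)
      from le[OF this] have "f v \<bullet> v + 2 * s * (f v \<bullet> r) + s^2 * (f r \<bullet> r)
            \<le> c * (v \<bullet> v + 2 * s * (v \<bullet> r) + s^2 * (r \<bullet> r))"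
        by (simp add: add scale inner_add_left inner_add_right frv inner_commute[of r v]
            power2_eq_square distrib_left mult.assoc mult.left_commute[of s c])
      then show ?thesis unfolding fvr vv c_def[symmetric] q_def by (simp add: algebra_simps)
    qed
    have q0: "q > 0" using key[of 1] rr by (simp del: inner_gt_zero_iff)
    have "2 * (r \<bullet> r / q) * (r \<bullet> r) \<le> (r \<bullet> r / q)^2 * q" by (rule key)
    then have "2 * (r \<bullet> r)^2 \<le> (r \<bullet> r)^2"
      using q0 by (simp add: divide_simps power2_eq_square)
    then show False using rr by simp
  qed
  then show ?thesis using that[of v c] v by (simp add: r_def)
qed

text \<open>
  The spectral theorem, for invariant subspaces so that the orthogonal complement of an eigenvector
  within \<open>S\<close> is again covered by the induction.
\<close>
lemma selfadjoint_orthonormal_eigenbasis: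
  fixes f :: "'a::euclidean_space \<Rightarrow> 'a"
  assumes f: "linear f" and sa: "\<And>x y. f x \<bullet> y = x \<bullet> f y"
    and S: "subspace S" "f ` S \<subseteq> S"
  shows "\<exists>B. pairwise orthogonal B \<and> (\<forall>x\<in>B. norm x = 1 \<and> (\<exists>c. f x = c *\<^sub>R x)) \<and> span B = S"
  using S
proof (induction "dim S" arbitrary: S rule: less_induct)
  case less
  show ?case
  proof (cases "S = {0}")
    case True
    then show ?thesis by (intro exI[of _ "{}"]) simp
  next
    case False
    obtain v c where v: "v \<in> S" "norm v = 1" "f v = c *\<^sub>R v"
      using selfadjoint_eigenvector_in_subspace[OF f sa less.prems False] by blast
    have vv: "v \<bullet> v = 1" using v by (simp add: norm_eq_1)
    define T where "T = S \<inter> {x. v \<bullet> x = 0}"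
    have T: "subspace T"
      unfolding T_def by (intro subspace_inter less.prems subspace_hyperplane)
    have fT: "f ` T \<subseteq> T"
      using less.prems v by (auto simp: T_def sa[symmetric])
    have "v \<notin> T" using vv by (simp add: T_def)
    then have "T \<subset> S" using v(1) T_def by blast
    moreover have "span T = T" "span S = S"
      using T less.prems(1) by (simp_all only: span_eq_iff)
    ultimately have "dim T < dim S" by (metis dim_psubset)
    with fT obtain B where B: "pairwise orthogonal B"
        "\<forall>x\<in>B. norm x = 1 \<and> (\<exists>c. f x = c *\<^sub>R x)" "span B = T"
      using less.hyps T by blast
    have BT: "B \<subseteq> T" using B(3) span_superset by blast
    have "pairwise orthogonal (insert v B)"
      using BT by (auto simp: pairwise_insert B T_def orthogonal_def inner_commute)
    moreover have "span (insert v B) = S"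
    proof
      show "span (insert v B) \<subseteq> S"
        using BT v less.prems by (intro span_minimal) (auto simp: T_def)
      show "S \<subseteq> span (insert v B)"
      proof
        fix w assume "w \<in> S"
        then have "w - (v \<bullet> w) *\<^sub>R v \<in> T"
          using v vv less.prems by (auto simp: T_def inner_diff subspace_diff subspace_scale)
        then show "w \<in> span (insert v B)"
          unfolding B(3)[symmetric] span_insert by auto
      qed
    qed
    ultimately show ?thesis using B v by (intro exI[of _ "insert v B"]) auto
  qed
qed

text \<open>
  Indexing the basis by the coordinate type lets its vectors serve as the columns of a square matrix and
  counts the eigenvalues with multiplicity.
\<close>
definition eigenframe :: "real^'n^'n \<Rightarrow> ('n::finite \<Rightarrow> real^'n) \<Rightarrow> ('n \<Rightarrow> real) \<Rightarrow> bool" where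
  "eigenframe A p d \<longleftrightarrow>
     (\<forall>i j. p i \<bullet> p j = (if i = j then 1 else 0)) \<and> (\<forall>i. A *v p i = d i *\<^sub>R p i)"

lemma eigenframe_exists:
  fixes A :: "real^'n^'n::finite"
  assumes "transpose A = A"
  obtains p d where "eigenframe A p d"
proof -
  have sa: "(A *v x) \<bullet> y = x \<bullet> (A *v y)" for x y
    by (metis assms dot_lmul_matrix vector_transpose_matrix)
  obtain B where B: "pairwise orthogonal B" "\<forall>x\<in>B. norm x = 1 \<and> (\<exists>c. A *v x = c *\<^sub>R x)"
      "span B = (UNIV :: (real^'n) set)"
    using selfadjoint_orthonormal_eigenbasis[of "(*v) A" UNIV] sa by auto
  have "independent B"
    using B by (intro pairwise_orthogonal_independent) auto
  then have "finite B" "card B = CARD('n)"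
    using B(3) dim_eq_card[of B "UNIV :: (real^'n) set"] by (simp_all add: independent_imp_finite)
  then obtain p where p: "bij_betw p (UNIV :: 'n set) B"
    by (metis finite bij_betw_iff_card)
  then have pB: "p i \<in> B" for i by (auto simp: bij_betw_def)
  have "p i \<bullet> p j = (if i = j then 1 else 0)" for i j
  proof (cases "i = j")
    case True
    then show ?thesis using B(2) pB by (auto simp: norm_eq_1)
  next
    case False
    then have "p i \<noteq> p j" using p by (auto simp: bij_betw_def inj_def)
    then show ?thesis using B(1) pB False by (auto simp: pairwise_def orthogonal_def)
  qed
  moreover have "\<forall>i. \<exists>c. A *v p i = c *\<^sub>R p i" using B(2) pB by blast
  then have "\<exists>d. \<forall>i. A *v p i = d i *\<^sub>R p i" by (rule choice)
  ultimately show ?thesis using that unfolding eigenframe_def by auto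
qed

lemma eigenframe_expand:
  fixes A :: "real^'n^'n::finite"
  assumes "eigenframe A p d"
  shows "x = (\<Sum>i\<in>UNIV. (p i \<bullet> x) *\<^sub>R p i)"
proof -
  define Q where "Q = (\<chi> i j. p j $ i)"
  have col: "column j Q = p j" for j by (simp add: Q_def column_def vec_eq_iff)
  have "orthogonal_matrix Q"
    using assms by (auto simp: orthogonal_matrix_orthonormal_columns col eigenframe_def norm_eq_1 orthogonal_def)
  then have "Q ** transpose Q = mat 1" by (simp add: orthogonal_matrix_def)
  then have "x = Q *v (transpose Q *v x)"
    by (simp only: matrix_vector_mul_assoc matrix_vector_mul_lid)
  also have "\<dots> = (\<Sum>i\<in>UNIV. (p i \<bullet> x) *\<^sub>R p i)"
  proof -
    have "(transpose Q *v x) $ i = p i \<bullet> x" for i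
      by (simp add: transpose_def Q_def inner_vec_def matrix_vector_mult_def)
    then show ?thesis
      by (simp only: matrix_mult_sum col scalar_mult_eq_scaleR)
  qed
  finally show ?thesis .
qed

lemma eigenframe_inner:
  fixes A :: "real^'n^'n::finite"
  assumes "eigenframe A p d"
  shows "x \<bullet> y = (\<Sum>i\<in>UNIV. (p i \<bullet> x) * (p i \<bullet> y))"
  by (subst eigenframe_expand[OF assms, of x]) (simp add: inner_sum_left)

lemma eigenframe_quadratic:
  fixes A :: "real^'n^'n::finite"
  assumes "eigenframe A p d"
  shows "(A *v x) \<bullet> x = (\<Sum>i\<in>UNIV. d i * (p i \<bullet> x)^2)"
proof -
  have "A *v x = (\<Sum>i\<in>UNIV. (p i \<bullet> x) *\<^sub>R (d i *\<^sub>R p i))"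
    by (subst eigenframe_expand[OF assms, of x])
       (use assms in \<open>simp add: eigenframe_def linear_sum[OF matrix_vector_mul_linear] o_def
          matrix_vector_mult_scaleR\<close>)
  then show ?thesis
    by (simp add: inner_sum_left power2_eq_square mult_ac)
qed

text \<open>
  Conjugation by the matrix of the frame diagonalises \<open>A\<close>, so the characteristic polynomial splits into the
  linear factors belonging to \<open>d\<close>. This connects the roots of a polynomial with quadratic form estimates.
\<close>
lemma eigenvalues_eigenframe:
  fixes A :: "real^'n^'n::finite"
  assumes ef: "eigenframe A p d"
  shows "eigenvalues A = image_mset d (mset_set UNIV)"
proof -
  define Q where "Q = (\<chi> i j. p j $ i)"
  have col: "column j Q = p j" for j by (simp add: Q_def column_def vec_eq_iff)
  have "orthogonal_matrix Q"
    using ef by (auto simp: orthogonal_matrix_orthonormal_columns col eigenframe_def norm_eq_1 orthogonal_def)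
  then have Q: "transpose Q ** Q = mat 1" by (simp add: orthogonal_matrix_def)
  have "poly (charpoly A) t = poly (\<Prod>i\<in>UNIV. [:- d i, 1:]) t" for t
  proof -
    define D where "D = (\<chi> i j. if i = j then t - d i else 0)"
    have "(mat t - A) ** Q = Q ** D"
    proof -
      have "((mat t - A) ** Q) $ i $ j = (Q ** D) $ i $ j" for i j
      proof -
        have "((mat t - A) ** Q) $ i $ j = ((mat t - A) *v p j) $ i"
          by (simp add: matrix_matrix_mult_def matrix_vector_mult_def Q_def)
        also have "\<dots> = (t - d j) * p j $ i"
        proof -
          have "mat t *v p j = t *\<^sub>R p j"
            by (simp add: vec_eq_iff matrix_vector_mult_def mat_def if_distrib if_distribR cong: if_cong)
          then show ?thesis
            using ef by (simp add: matrix_vector_mult_diff_rdistrib eigenframe_def left_diff_distrib)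
        qed
        also have "\<dots> = (Q ** D) $ i $ j"
          by (simp add: matrix_matrix_mult_def D_def Q_def if_distrib if_distribR cong: if_cong)
        finally show ?thesis .
      qed
      then show ?thesis by (simp add: vec_eq_iff)
    qed
    then have "det (mat t - A) * det Q = det Q * det D" by (metis det_mul)
    moreover have "det Q \<noteq> 0" using arg_cong[OF Q, of det] by (auto simp: det_mul)
    ultimately have "det (mat t - A) = det D" by simp
    also have "\<dots> = (\<Prod>i\<in>UNIV. t - d i)"
      by (subst det_diagonal) (auto simp: D_def)
    finally show ?thesis by (simp add: charpoly_eq poly_prod)
  qed
  then have "charpoly A = (\<Prod>i\<in>UNIV. [:- d i, 1:])" by (simp add: poly_eq_poly_eq_iff[symmetric] fun_eq_iff)
  then show ?thesis
    by (simp add: eigenvalues_def proots_prod sum_unfold_sum_mset) 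
qed

section \<open>Second derivatives\<close>

definition dir_deriv :: "(real^'n::finite \<Rightarrow> real) \<Rightarrow> real^'n \<Rightarrow> real^'n \<Rightarrow> real" where
  "dir_deriv f w x = (\<Sum>i\<in>UNIV. w $ i * partial_deriv i f x)"

lemma dir_deriv_axis: "dir_deriv f (axis i 1) = partial_deriv i f"
  by (simp add: fun_eq_iff dir_deriv_def axis_def if_distrib if_distribR cong: if_cong)

lemma has_real_derivative_line:
  fixes f :: "real^'n::finite \<Rightarrow> real"
  assumes "f differentiable (at (x + s *\<^sub>R w))"
  shows "((\<lambda>s. f (x + s *\<^sub>R w)) has_real_derivative dir_deriv f w (x + s *\<^sub>R w)) (at s)"
proof -
  let ?D = "frechet_derivative f (at (x + s *\<^sub>R w))"
  have D: "(f has_derivative ?D) (at (x + s *\<^sub>R w))"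
    using assms by (simp add: frechet_derivative_works)
  then have lin: "linear ?D" by (rule has_derivative_linear)
  have "((\<lambda>s. x + s *\<^sub>R w) has_derivative (\<lambda>h. h *\<^sub>R w)) (at s)"
    by (auto intro!: derivative_eq_intros)
  from diff_chain_at[OF this D]
  have "((\<lambda>s. f (x + s *\<^sub>R w)) has_derivative (\<lambda>h. ?D (h *\<^sub>R w))) (at s)"
    by (simp add: o_def)
  moreover have "?D w = dir_deriv f w (x + s *\<^sub>R w)"
  proof -
    have "?D w = ?D (\<Sum>i\<in>UNIV. w $ i *\<^sub>R axis i 1)"
      using basis_expansion[of w] by (simp add: scalar_mult_eq_scaleR)
    then show ?thesis
      by (simp add: linear_sum[OF lin] linear_cmul[OF lin] dir_deriv_def partial_deriv_def)
  qed
  ultimately show ?thesis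
    by (simp add: has_field_derivative_def linear_cmul[OF lin] mult.commute[of _ "dir_deriv f w _"])
qed

text \<open>
  Two applications of the mean value theorem, first in direction \<open>i\<close> and then in direction \<open>j\<close>. The left
  side is symmetric in \<open>i\<close> and \<open>j\<close>, so letting \<open>h\<close> tend to zero makes mixed partial derivatives commute.
\<close>
lemma second_difference_mean_value:
  fixes f :: "real^'n::finite \<Rightarrow> real"
  assumes f: "\<And>z. z \<in> ball x r \<Longrightarrow> f differentiable (at z)"
    and fi: "\<And>z. z \<in> ball x r \<Longrightarrow> partial_deriv i f differentiable (at z)"
    and h: "0 < h" "2 * h < r"
  shows "\<exists>p \<in> cball x (2 * h). f (x + h *\<^sub>R axis i 1 + h *\<^sub>R axis j 1) - f (x + h *\<^sub>R axis i 1)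
      - f (x + h *\<^sub>R axis j 1) + f x = h\<^sup>2 * partial_deriv j (partial_deriv i f) p"
proof -
  have near: "norm (s *\<^sub>R axis i 1 + t *\<^sub>R axis j (1::real)) \<le> 2 * h"
    if "0 \<le> s" "s \<le> h" "0 \<le> t" "t \<le> h" for s t
  proof -
    have "norm (s *\<^sub>R axis i 1 + t *\<^sub>R axis j (1::real)) \<le> \<bar>s\<bar> + \<bar>t\<bar>"
      by (rule order.trans[OF norm_triangle_ineq]) simp
    then show ?thesis using that by simp
  qed
  have inball: "x + t *\<^sub>R axis j 1 + s *\<^sub>R axis i 1 \<in> ball x r"
      "x + s *\<^sub>R axis i 1 + t *\<^sub>R axis j 1 \<in> ball x r"
    if "0 \<le> s" "s \<le> h" "0 \<le> t" "t \<le> h" for s t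
  proof -
    have *: "x + a \<in> ball x r" if "norm a < r" for a :: "real^'n" using that by (simp add: dist_norm)
    have "x + (s *\<^sub>R axis i 1 + t *\<^sub>R axis j 1) \<in> ball x r"
      using near[OF that] h by (intro *) linarith
    then show "x + t *\<^sub>R axis j 1 + s *\<^sub>R axis i 1 \<in> ball x r"
      "x + s *\<^sub>R axis i 1 + t *\<^sub>R axis j 1 \<in> ball x r"
      by (simp_all only: add_ac)
  qed
  define g where "g s = f (x + h *\<^sub>R axis j 1 + s *\<^sub>R axis i 1) - f (x + s *\<^sub>R axis i 1)" for s
  define g' where "g' s = partial_deriv i f (x + h *\<^sub>R axis j 1 + s *\<^sub>R axis i 1)
      - partial_deriv i f (x + s *\<^sub>R axis i 1)" for s
  have "(g has_real_derivative g' s) (at s)" if "0 \<le> s" "s \<le> h" for s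
    unfolding g_def g'_def dir_deriv_axis[symmetric]
    using inball(1)[of s h] inball(1)[of s 0] that h f
    by (intro DERIV_diff has_real_derivative_line) auto
  then obtain s where s: "0 < s" "s < h" "g h - g 0 = (h - 0) * g' s"
    using MVT2[of 0 h g g'] h by auto
  define k where "k t = partial_deriv i f (x + s *\<^sub>R axis i 1 + t *\<^sub>R axis j 1)" for t
  have k': "(k has_real_derivative partial_deriv j (partial_deriv i f) (x + s *\<^sub>R axis i 1 + t *\<^sub>R axis j 1)) (at t)"
    if "0 \<le> t" "t \<le> h" for t
    unfolding k_def dir_deriv_axis[of _ j, symmetric]
    using inball(2)[of s t] that s fi by (intro has_real_derivative_line) auto
  then obtain t where t: "0 < t" "t < h"
      "k h - k 0 = (h - 0) * partial_deriv j (partial_deriv i f) (x + s *\<^sub>R axis i 1 + t *\<^sub>R axis j 1)"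
    using MVT2[OF h(1) k'] by auto
  have "g' s = k h - k 0" by (simp add: g'_def k_def add_ac)
  then have "g h - g 0 = h\<^sup>2 * partial_deriv j (partial_deriv i f) (x + s *\<^sub>R axis i 1 + t *\<^sub>R axis j 1)"
    using s t by (simp add: power2_eq_square)
  moreover have "x + s *\<^sub>R axis i 1 + t *\<^sub>R axis j 1 \<in> cball x (2 * h)"
  proof -
    have *: "dist x (x + v) = norm v" for v by (simp add: dist_norm)
    show ?thesis using near[of s t] s t by (simp only: add.assoc mem_cball *)
  qed
  moreover have "f (x + h *\<^sub>R axis j 1 + h *\<^sub>R axis i 1) = f (x + h *\<^sub>R axis i 1 + h *\<^sub>R axis j 1)"
    by (simp only: add_ac)
  ultimately show ?thesis
    by (intro bexI[of _ "x + s *\<^sub>R axis i 1 + t *\<^sub>R axis j 1"]) (simp_all add: g_def)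
qed

lemma C_k_on_partial:
  assumes "C_k_on k S f" "x \<in> S"
  shows "0 < k \<Longrightarrow> f differentiable (at x)"
    and "1 < k \<Longrightarrow> partial_deriv i f differentiable (at x)"
    and "2 \<le> k \<Longrightarrow> continuous_on S (partial_deriv j (partial_deriv i f))"
proof -
  have d: "iter_partial is f differentiable (at x)" if "length is < k" for "is"
    using assms that by (simp add: C_k_on_def)
  have c: "continuous_on S (iter_partial is f)" if "length is \<le> k" for "is"
    using assms that by (simp add: C_k_on_def)
  show "0 < k \<Longrightarrow> f differentiable (at x)" using d[of "[]"] by simp
  show "1 < k \<Longrightarrow> partial_deriv i f differentiable (at x)" using d[of "[i]"] by simp
  show "2 \<le> k \<Longrightarrow> continuous_on S (partial_deriv j (partial_deriv i f))" using c[of "[j, i]"] by simp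
qed

lemma hessian_symmetric:
  fixes f :: "real^'n::finite \<Rightarrow> real"
  assumes S: "open S" "x \<in> S" and f: "C_k_on 2 S f"
  shows "transpose (hessian f x) = hessian f x"
proof -
  have "partial_deriv j (partial_deriv i f) x = partial_deriv i (partial_deriv j f) x" for i j
  proof (rule ccontr)
    define a where "a = partial_deriv j (partial_deriv i f)"
    define b where "b = partial_deriv i (partial_deriv j f)"
    assume "\<not> ?thesis"
    then have ne: "a x \<noteq> b x" by (simp add: a_def b_def)
    define \<epsilon> where "\<epsilon> = \<bar>a x - b x\<bar> / 2"
    have e: "\<epsilon> > 0" using ne by (simp add: \<epsilon>_def)
    obtain r where r: "r > 0" "ball x r \<subseteq> S" using S by (meson openE)
    have "isCont a x" "isCont b x"
      using C_k_on_partial(3)[OF f S(2)] S by (auto simp: a_def b_def continuous_on_eq_continuous_at)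
    then obtain d1 d2 where d: "d1 > 0" "d2 > 0"
      "\<And>z. dist z x < d1 \<Longrightarrow> dist (a z) (a x) < \<epsilon>" "\<And>z. dist z x < d2 \<Longrightarrow> dist (b z) (b x) < \<epsilon>"
      using e unfolding continuous_at_eps_delta by metis
    define h where "h = min r (min d1 d2) / 4"
    have h: "0 < h" "2 * h < r" "2 * h < d1" "2 * h < d2" using r d by (auto simp: h_def)
    have D: "\<And>z. z \<in> ball x r \<Longrightarrow> f differentiable (at z)"
      "\<And>z i. z \<in> ball x r \<Longrightarrow> partial_deriv i f differentiable (at z)"
      using C_k_on_partial(1,2)[OF f] r by auto
    obtain p where p: "p \<in> cball x (2 * h)" "f (x + h *\<^sub>R axis i 1 + h *\<^sub>R axis j 1) - f (x + h *\<^sub>R axis i 1)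
      - f (x + h *\<^sub>R axis j 1) + f x = h\<^sup>2 * a p"
      using second_difference_mean_value[of x r f i h j] D h unfolding a_def by blast
    obtain q where q: "q \<in> cball x (2 * h)" "f (x + h *\<^sub>R axis j 1 + h *\<^sub>R axis i 1) - f (x + h *\<^sub>R axis j 1)
      - f (x + h *\<^sub>R axis i 1) + f x = h\<^sup>2 * b q"
      using second_difference_mean_value[of x r f j h i] D h unfolding b_def by blast
    have "f (x + h *\<^sub>R axis j 1 + h *\<^sub>R axis i 1) = f (x + h *\<^sub>R axis i 1 + h *\<^sub>R axis j 1)"
      by (simp only: add_ac)
    then have "h\<^sup>2 * a p = h\<^sup>2 * b q" using p(2) q(2) by linarith
    then have "a p = b q" using h by simp
    moreover have "dist (a p) (a x) < \<epsilon>" "dist (b q) (b x) < \<epsilon>"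
      using p(1) q(1) h by (auto intro!: d simp: dist_commute)
    ultimately show False by (auto simp: \<epsilon>_def dist_real_def abs_if split: if_splits)
  qed
  then show ?thesis by (simp add: hessian_def transpose_def vec_eq_iff)
qed

lemma has_real_derivative_dir_deriv_line:
  fixes f :: "real^'n::finite \<Rightarrow> real"
  assumes f: "C_k_on 2 S f" and S: "x + s *\<^sub>R w \<in> S"
  shows "((\<lambda>s. dir_deriv f w (x + s *\<^sub>R w)) has_real_derivative
     (hessian f (x + s *\<^sub>R w) *v w) \<bullet> w) (at s)"
proof -
  let ?z = "x + s *\<^sub>R w"
  have "((\<lambda>s. dir_deriv f w (x + s *\<^sub>R w)) has_real_derivative
     (\<Sum>i\<in>UNIV. w $ i * dir_deriv (partial_deriv i f) w ?z)) (at s)"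
    unfolding dir_deriv_def[of f]
    by (intro DERIV_sum DERIV_cmult has_real_derivative_line C_k_on_partial(2)[OF f S]) simp
  also have "(\<Sum>i\<in>UNIV. w $ i * dir_deriv (partial_deriv i f) w ?z)
      = (\<Sum>i\<in>UNIV. \<Sum>j\<in>UNIV. w $ i * (w $ j * partial_deriv j (partial_deriv i f) ?z))"
    by (simp add: dir_deriv_def sum_distrib_left)
  also have "\<dots> = (\<Sum>j\<in>UNIV. \<Sum>i\<in>UNIV. w $ i * (w $ j * partial_deriv j (partial_deriv i f) ?z))"
    by (rule sum.swap)
  also have "\<dots> = (hessian f ?z *v w) \<bullet> w"
    by (simp add: inner_vec_def matrix_vector_mult_def hessian_def sum_distrib_left sum_distrib_right mult_ac)
  finally show ?thesis .
qed

lemma second_derivative_le_zero_at_local_max: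
  fixes g :: "real \<Rightarrow> real"
  assumes g: "\<And>s. \<bar>s\<bar> < \<delta> \<Longrightarrow> (g has_real_derivative g' s) (at s)"
    and g': "(g' has_real_derivative D) (at 0)"
    and \<delta>: "\<delta> > 0" and max: "\<And>s. \<bar>s\<bar> < \<delta> \<Longrightarrow> g s \<le> g 0"
  shows "D \<le> 0"
proof (rule ccontr)
  assume "\<not> D \<le> 0"
  then obtain d where d: "d > 0" "\<And>h. 0 < h \<Longrightarrow> h < d \<Longrightarrow> g' 0 < g' h"
    using DERIV_pos_inc_right[OF g'] by auto
  have "g' 0 = 0"
    using DERIV_local_max[OF g[of 0] \<delta>] max \<delta> by auto
  define h where "h = min d \<delta> / 2"
  have h: "0 < h" "h < d" "h < \<delta>" using d \<delta> by (auto simp: h_def)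
  obtain z where z: "0 < z" "z < h" "g h - g 0 = (h - 0) * g' z"
    using MVT2[of 0 h g g'] h g by force
  then have "g h - g 0 > 0" using d(2)[of z] \<open>g' 0 = 0\<close> h by simp
  then show False using max[of h] h by simp
qed

section \<open>Eigenvalues in the critical phase\<close>

lemma pi_half_minus_arctan: 
  fixes x :: real
  assumes "0 < x"
  shows "pi / 2 - 1 / x \<le> arctan x"
  using arctan_inverse[of x] arctan_le_self[of "inverse x"] assms by (simp add: inverse_eq_divide)

text \<open>
  This is where the critical phase enters: the other \<open>n - 2\<close> summands contribute less than \<open>\<pi> / 2\<close> each,
  so any two eigenvalues have a nonnegative sum. In particular at most one eigenvalue is negative, and it
  is the smallest in absolute value.
\<close>
lemma critical_phase_dominates:
  fixes d :: "'n::finite \<Rightarrow> real"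
  assumes ph: "(real CARD('n) - 2) * (pi / 2) \<le> (\<Sum>i\<in>UNIV. arctan (d i))" and ik: "i \<noteq> k"
  shows "- d k \<le> d i"
proof -
  have "(\<Sum>j\<in>UNIV. arctan (d j)) = arctan (d k) + (\<Sum>j\<in>UNIV - {k}. arctan (d j))"
    by (simp add: sum.remove)
  also have "(\<Sum>j\<in>UNIV - {k}. arctan (d j)) = arctan (d i) + (\<Sum>j\<in>UNIV - {k} - {i}. arctan (d j))"
    using ik by (intro sum.remove) auto
  also have "(\<Sum>j\<in>UNIV - {k} - {i}. arctan (d j)) \<le> of_nat (card (UNIV - {k} - {i})) * (pi / 2)"
    by (intro sum_bounded_above) (use arctan_ubound less_imp_le in blast)
  also have "card (UNIV - {k} - {i}) = CARD('n) - 2"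
    using ik by (simp add: card_Diff_singleton)
  also have "real (CARD('n) - 2) = real CARD('n) - 2"
  proof -
    have "card {i, k} \<le> CARD('n)" by (intro card_mono) auto
    then show ?thesis using ik by (simp add: of_nat_diff)
  qed
  finally have "0 \<le> arctan (d k) + arctan (d i)" using ph by simp
  then have "arctan (- d k) \<le> arctan (d i)" by (simp add: arctan_minus)
  then show ?thesis by (simp only: arctan_le_iff)
qed

text \<open>
  The hypothesis relating \<open>A\<close> and \<open>B\<close> is the second variation inequality. Taking \<open>\<xi> + t e = 0\<close> in it
  makes \<open>A\<close> very negative in direction \<open>e\<close>. So \<open>A\<close> has an eigenvalue \<open>d k\<close> at most \<open>- (a + 2 K)\<close>, which
  costs almost \<open>\<pi>\<close> of the maximal phase \<open>n \<pi> / 2\<close>, while by criticality the form of \<open>A\<close> is at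
  least \<open>- d k\<close> times the square of the norm on the orthogonal complement of \<open>p k\<close>. Any vector \<open>\<zeta>\<close> can be
  written as \<open>\<xi> + t e\<close> with \<open>\<xi>\<close> in that complement, and the hypothesis then bounds the form of \<open>B\<close> at
  \<open>\<zeta>\<close> from below. Thus all eigenvalues of \<open>B\<close> are large, and its phase is close to maximal.
\<close>
lemma doubling_phase_gap:
  fixes A B :: "real^'n^'n::finite"
  assumes A: "eigenframe A p d" and B: "eigenframe B q \<mu>"
    and e: "norm e = 1" and a: "a > 0" and K: "K \<ge> 0"
    and AB: "\<And>\<xi> t. (A *v \<xi>) \<bullet> \<xi> + (a + 4 * K) * t\<^sup>2 - 2 * K * (\<xi> \<bullet> \<xi>)
        \<le> (B *v (\<xi> + t *\<^sub>R e)) \<bullet> (\<xi> + t *\<^sub>R e)"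
    and ph: "(real CARD('n) - 2) * (pi / 2) \<le> (\<Sum>i\<in>UNIV. arctan (d i))"
  shows "(\<Sum>i\<in>UNIV. arctan (d i)) \<le> (real CARD('n) - 2) * (pi / 2) + 1 / a"
    and "real CARD('n) * (pi / 2 - 2 / a) \<le> (\<Sum>i\<in>UNIV. arctan (\<mu> i))"
proof -
  have ee: "e \<bullet> e = 1" using e by (simp add: norm_eq_1)
  have Aee: "(A *v e) \<bullet> e \<le> - (a + 2 * K)"
    using AB[of "- e" 1] ee by (simp add: vec.neg)
  obtain k where k: "\<And>i. d k \<le> d i"
    using ex_min_if_finite[of "range d"] by (metis finite finite_imageI image_is_empty UNIV_not_empty imageE rangeI not_le)
  have "d k = (\<Sum>i\<in>UNIV. d k * (p i \<bullet> e)\<^sup>2)"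
    using eigenframe_inner[OF A, of e e] ee by (simp add: sum_distrib_left[symmetric] power2_eq_square)
  also have "\<dots> \<le> (A *v e) \<bullet> e"
    unfolding eigenframe_quadratic[OF A] by (intro sum_mono mult_right_mono k) simp
  finally have dk: "a + 2 * K \<le> - d k" using Aee by simp
  have di: "- d k \<le> d i" if "i \<noteq> k" for i
    using critical_phase_dominates[OF ph that] .

  have "arctan (d i) \<le> pi / 2" for i using arctan_ubound[of "d i"] by simp
  then have "(\<Sum>i\<in>UNIV - {k}. arctan (d i)) \<le> of_nat (card (UNIV - {k})) * (pi / 2)"
    by (intro sum_bounded_above)
  moreover have "real (card (UNIV - {k})) = real CARD('n) - 1"
    by (simp add: card_Diff_singleton of_nat_diff Suc_leI)
  moreover have "arctan (d k) \<le> - (pi / 2) + 1 / a"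
  proof -
    have "pi / 2 - 1 / (- d k) \<le> - arctan (d k)"
      using pi_half_minus_arctan[of "- d k"] dk a K by (simp add: arctan_minus)
    moreover have "1 / (- d k) \<le> 1 / a"
      using dk a K by (intro divide_left_mono mult_pos_pos) auto
    ultimately show ?thesis by simp
  qed
  moreover have "(\<Sum>i\<in>UNIV. arctan (d i)) = arctan (d k) + (\<Sum>i\<in>UNIV - {k}. arctan (d i))"
    by (simp add: sum.remove)
  ultimately show "(\<Sum>i\<in>UNIV. arctan (d i)) \<le> (real CARD('n) - 2) * (pi / 2) + 1 / a"
    by (simp add: algebra_simps)

  have coer: "- d k * (\<xi> \<bullet> \<xi>) \<le> (A *v \<xi>) \<bullet> \<xi>" if "p k \<bullet> \<xi> = 0" for \<xi>
  proof -
    have "- d k * (\<xi> \<bullet> \<xi>) = (\<Sum>i\<in>UNIV. - d k * (p i \<bullet> \<xi>)\<^sup>2)"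
      by (subst eigenframe_inner[OF A]) (simp add: sum_distrib_left power2_eq_square sum_negf)
    also have "\<dots> \<le> (A *v \<xi>) \<bullet> \<xi>"
      unfolding eigenframe_quadratic[OF A]
    proof (rule sum_mono)
      fix i show "- d k * (p i \<bullet> \<xi>)\<^sup>2 \<le> d i * (p i \<bullet> \<xi>)\<^sup>2"
        using that mult_right_mono[OF di, of i "(p i \<bullet> \<xi>)\<^sup>2"] by (cases "i = k") auto
    qed
    finally show ?thesis .
  qed
  \<comment> \<open>Otherwise \<open>e\<close> would lie in the subspace on which the form of \<open>A\<close> is positive.\<close>
  have pe: "p k \<bullet> e \<noteq> 0"
    using coer[of e] ee Aee dk a K by auto
  have Blow: "a / 2 * (\<zeta> \<bullet> \<zeta>) \<le> (B *v \<zeta>) \<bullet> \<zeta>" for \<zeta>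
  proof -
    define t where "t = (p k \<bullet> \<zeta>) / (p k \<bullet> e)"
    define \<xi> where "\<xi> = \<zeta> - t *\<^sub>R e"
    have "p k \<bullet> \<xi> = 0" using pe by (simp add: \<xi>_def t_def inner_diff_right)
    then have "- d k * (\<xi> \<bullet> \<xi>) \<le> (A *v \<xi>) \<bullet> \<xi>" by (rule coer)
    moreover have "(a + 2 * K) * (\<xi> \<bullet> \<xi>) \<le> - d k * (\<xi> \<bullet> \<xi>)"
      by (intro mult_right_mono dk) simp
    moreover have "0 \<le> K * t\<^sup>2" using K by simp
    moreover have "\<zeta> = \<xi> + t *\<^sub>R e" by (simp add: \<xi>_def)
    ultimately have 1: "a * (\<xi> \<bullet> \<xi>) + a * t\<^sup>2 \<le> (B *v \<zeta>) \<bullet> \<zeta>"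
      using AB[of \<xi> t] by (simp add: algebra_simps)
    have "\<zeta> \<bullet> \<zeta> + (\<xi> - t *\<^sub>R e) \<bullet> (\<xi> - t *\<^sub>R e) = 2 * (\<xi> \<bullet> \<xi> + t\<^sup>2)"
      unfolding \<open>\<zeta> = \<xi> + t *\<^sub>R e\<close>
      by (simp add: inner_add_left inner_add_right inner_diff_left inner_diff_right ee power2_eq_square
          inner_commute[of e \<xi>] distrib_left right_diff_distrib)
    then have "\<zeta> \<bullet> \<zeta> \<le> 2 * (\<xi> \<bullet> \<xi> + t\<^sup>2)"
      using inner_ge_zero[of "\<xi> - t *\<^sub>R e"] by linarith
    then have "a / 2 * (\<zeta> \<bullet> \<zeta>) \<le> a / 2 * (2 * (\<xi> \<bullet> \<xi> + t\<^sup>2))"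
      using a by (intro mult_left_mono) auto
    then show ?thesis using 1 by (simp add: algebra_simps)
  qed
  have "pi / 2 - 2 / a \<le> arctan (\<mu> i)" for i
  proof -
    have "q i \<bullet> q i = 1" "B *v q i = \<mu> i *\<^sub>R q i" using B by (auto simp: eigenframe_def)
    then have "a / 2 \<le> \<mu> i" using Blow[of "q i"] by simp
    then have "arctan (a / 2) \<le> arctan (\<mu> i)" by (simp only: arctan_le_iff)
    then show ?thesis using pi_half_minus_arctan[of "a / 2"] a by simp
  qed
  then show "real CARD('n) * (pi / 2 - 2 / a) \<le> (\<Sum>i\<in>UNIV. arctan (\<mu> i))"
    using sum_bounded_below[of UNIV "pi / 2 - 2 / a" "\<lambda>i. arctan (\<mu> i)"] by simp
qed

section \<open>Doubling of variables\<close>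

text \<open>
  The doubled function is perturbed along \<open>s \<mapsto> (x + s \<xi>, y + s (\<xi> + t e))\<close>. As
  \<open>e\<close> points along \<open>x - y\<close>, the difference of the two points stays on the same ray, its norm is
  exactly \<open>r - s t\<close> for small \<open>s\<close>, and the penalty restricted to the path is a quadratic polynomial in \<open>s\<close>. A
  nonpositive second derivative at \<open>s = 0\<close> is the asserted inequality.
\<close>
lemma doubling_second_variation:
  fixes u :: "real^'n::finite \<Rightarrow> real"
  assumes S: "open S" "x \<in> S" "y \<in> S" and u: "C_k_on 2 S u"
    and r: "r = norm (x - y)" "r > 0" and e: "e = (1 / r) *\<^sub>R (x - y)"
    and max: "\<forall>\<^sub>F z in nhds (x, y).
      u (fst z) - u (snd z) - (L * norm (fst z - snd z) - b / 2 * (norm (fst z - snd z))\<^sup>2) - K * (fst z \<bullet> fst z)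
      \<le> u x - u y - (L * norm (x - y) - b / 2 * (norm (x - y))\<^sup>2) - K * (x \<bullet> x)"
  shows "(hessian u x *v \<xi>) \<bullet> \<xi> + b * t\<^sup>2 - 2 * K * (\<xi> \<bullet> \<xi>)
        \<le> (hessian u y *v (\<xi> + t *\<^sub>R e)) \<bullet> (\<xi> + t *\<^sub>R e)"
proof -
  define \<zeta> where "\<zeta> = \<xi> + t *\<^sub>R e"
  define g where "g s = u (x + s *\<^sub>R \<xi>) - u (y + s *\<^sub>R \<zeta>)
    - (L * (r - s * t) - b / 2 * (r - s * t)\<^sup>2) - K * (x \<bullet> x + 2 * s * (x \<bullet> \<xi>) + s\<^sup>2 * (\<xi> \<bullet> \<xi>))" for s
  define g' where "g' s = dir_deriv u \<xi> (x + s *\<^sub>R \<xi>) - dir_deriv u \<zeta> (y + s *\<^sub>R \<zeta>)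
    - (- (L * t) + b * t * (r - s * t)) - K * (2 * (x \<bullet> \<xi>) + 2 * s * (\<xi> \<bullet> \<xi>))" for s
  let ?path = "\<lambda>s. (x + s *\<^sub>R \<xi>, y + s *\<^sub>R \<zeta>)"
  have ne: "norm e = 1" using r by (simp add: e)
  have lim: "(?path \<longlongrightarrow> (x, y)) (nhds 0)"
  proof -
    have "isCont ?path 0" by (intro continuous_intros)
    then show ?thesis using tendsto_at_iff_tendsto_nhds[of ?path 0] by (simp add: isCont_def)
  qed
  have "\<forall>\<^sub>F s in nhds 0. ?path s \<in> S \<times> S"
    using S by (intro topological_tendstoD[OF lim] open_Times) auto
  moreover have "\<forall>\<^sub>F s in nhds (0::real). r - s * t > 0"
  proof -
    have "((\<lambda>s. r - s * t) \<longlongrightarrow> r - 0 * t) (nhds 0)"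
      by (intro tendsto_intros filterlim_ident)
    then show ?thesis using r by (intro order_tendstoD(1)[of _ "r - 0 * t"]) auto
  qed
  moreover have "\<forall>\<^sub>F s in nhds 0. u (fst (?path s)) - u (snd (?path s))
      - (L * norm (fst (?path s) - snd (?path s)) - b / 2 * (norm (fst (?path s) - snd (?path s)))\<^sup>2)
      - K * (fst (?path s) \<bullet> fst (?path s))
      \<le> u x - u y - (L * norm (x - y) - b / 2 * (norm (x - y))\<^sup>2) - K * (x \<bullet> x)"
    using max lim by (rule eventually_compose_filterlim)
  ultimately have "\<forall>\<^sub>F s in nhds 0. x + s *\<^sub>R \<xi> \<in> S \<and> y + s *\<^sub>R \<zeta> \<in> S \<and> g s \<le> g 0"
  proof eventually_elim
    case (elim s)
    have "x + s *\<^sub>R \<xi> - (y + s *\<^sub>R \<zeta>) = (r - s * t) *\<^sub>R e"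
      using r by (simp add: \<zeta>_def e algebra_simps)
    then have "norm (x + s *\<^sub>R \<xi> - (y + s *\<^sub>R \<zeta>)) = r - s * t"
      using elim(2) ne by simp
    moreover have "(x + s *\<^sub>R \<xi>) \<bullet> (x + s *\<^sub>R \<xi>) = x \<bullet> x + 2 * s * (x \<bullet> \<xi>) + s\<^sup>2 * (\<xi> \<bullet> \<xi>)"
      by (simp add: inner_add_left inner_add_right inner_commute[of \<xi> x] power2_eq_square distrib_left)
    ultimately have "g s \<le> g 0"
      using elim(3) r(1) by (simp add: g_def)
    then show ?case using elim(1) by simp
  qed
  then obtain \<delta> where \<delta>: "\<delta> > 0" "\<And>s. \<bar>s\<bar> < \<delta> \<Longrightarrow> x + s *\<^sub>R \<xi> \<in> S \<and> y + s *\<^sub>R \<zeta> \<in> S \<and> g s \<le> g 0"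
    unfolding eventually_nhds_metric dist_real_def by auto
  have "(hessian u (x + 0 *\<^sub>R \<xi>) *v \<xi>) \<bullet> \<xi> - (hessian u (y + 0 *\<^sub>R \<zeta>) *v \<zeta>) \<bullet> \<zeta>
      - (- (b * t * t)) - K * (2 * (\<xi> \<bullet> \<xi>)) \<le> 0"
  proof (rule second_derivative_le_zero_at_local_max[where g = g and g' = g' and \<delta> = \<delta>])
    fix s :: real assume s: "\<bar>s\<bar> < \<delta>"
    have "((\<lambda>s. L * (r - s * t) - b / 2 * (r - s * t)\<^sup>2) has_real_derivative - (L * t) + b * t * (r - s * t)) (at s)"
      by (rule derivative_eq_intros refl | simp add: field_simps)+
    moreover have "((\<lambda>s. K * (x \<bullet> x + 2 * s * (x \<bullet> \<xi>) + s\<^sup>2 * (\<xi> \<bullet> \<xi>)))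
        has_real_derivative K * (2 * (x \<bullet> \<xi>) + 2 * s * (\<xi> \<bullet> \<xi>))) (at s)"
      by (auto intro!: derivative_eq_intros simp: algebra_simps)
    ultimately show "(g has_real_derivative g' s) (at s)"
      unfolding g_def g'_def using \<delta>(2)[OF s]
      by (intro DERIV_diff has_real_derivative_line C_k_on_partial(1)[OF u]) auto
  next
    have "((\<lambda>s. - (L * t) + b * t * (r - s * t)) has_real_derivative - (b * t * t)) (at 0)"
      by (auto intro!: derivative_eq_intros)
    moreover have "((\<lambda>s. K * (2 * (x \<bullet> \<xi>) + 2 * s * (\<xi> \<bullet> \<xi>))) has_real_derivative K * (2 * (\<xi> \<bullet> \<xi>))) (at 0)"
      by (auto intro!: derivative_eq_intros)
    ultimately show "(g' has_real_derivative (hessian u (x + 0 *\<^sub>R \<xi>) *v \<xi>) \<bullet> \<xi>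
      - (hessian u (y + 0 *\<^sub>R \<zeta>) *v \<zeta>) \<bullet> \<zeta> - (- (b * t * t)) - K * (2 * (\<xi> \<bullet> \<xi>))) (at 0)"
      unfolding g'_def using S(2,3)
      by (intro DERIV_diff has_real_derivative_dir_deriv_line[OF u]) auto
  qed (use \<delta> in auto)
  then show ?thesis by (simp add: \<zeta>_def power2_eq_square)
qed

lemma sum_arctan_eigenvalues:
  assumes "eigenframe A p d"
  shows "(\<Sum>l\<in>#eigenvalues A. arctan l) = (\<Sum>i\<in>UNIV. arctan (d i))"
  by (simp add: eigenvalues_eigenframe[OF assms] sum_unfold_sum_mset image_mset.compositionality o_def)

text \<open>
  The maximum of the doubled function over the compact set \<open>D\<close> of the proof cannot be positive. The choice
  \<open>L = 4 M + b / 8\<close> makes the radial penalty equal to \<open>M\<close> at distance \<open>1 / 4\<close>, and \<open>4 M |x|\<^sup>2\<close> equals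
  \<open>M\<close> at \<open>|x| = 1 / 2\<close>, so a positive maximum is interior. There the phase gap applies with
  \<open>a = 2 n\<close> and \<open>K = 4 M\<close>; this is the reason for \<open>b = a + 4 K\<close>. The radius \<open>1 / 4\<close> keeps the
  reflected point \<open>2 x - y\<close> inside the ball, which is what concavity of \<open>\<psi>\<close> needs.
\<close>
lemma doubling_estimate:
  fixes u \<psi> :: "real^'n::finite \<Rightarrow> real"
  assumes u: "C_k_on 2 (ball 0 1) u"
    and conc: "concave_on (ball 0 1) \<psi>"
    and crit: "\<And>x. x \<in> ball 0 1 \<Longrightarrow> \<psi> x \<ge> (real CARD('n) - 2) * (pi / 2)"
    and eq: "\<And>x. x \<in> ball 0 1 \<Longrightarrow> (\<Sum>l\<in>#eigenvalues (hessian u x). arctan l) = \<psi> x"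
    and osc: "\<And>x y. x \<in> ball 0 1 \<Longrightarrow> y \<in> ball 0 1 \<Longrightarrow> u x - u y \<le> M"
    and b: "b = 2 * real CARD('n) + 16 * M" and L: "L = 4 * M + b / 8"
    and xy: "norm x \<le> 1 / 2" "norm (x - y) \<le> 1 / 4"
  shows "u x - u y \<le> L * norm (x - y) - b / 2 * (norm (x - y))\<^sup>2 + 4 * M * (x \<bullet> x)"
proof (rule ccontr)
  assume neg: "\<not> ?thesis"
  let ?U = "ball 0 1 :: (real^'n) set"
  have M0: "M \<ge> 0" using osc[of 0 0] by simp
  have n1: "real CARD('n) \<ge> 1" by (simp add: Suc_leI)
  define \<phi> where "\<phi> r = L * r - b / 2 * r\<^sup>2" for r
  have \<phi>_nonneg: "\<phi> r \<ge> 0" if "0 \<le> r" "r \<le> 1 / 4" for r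
  proof -
    have "b * r \<le> b * (1 / 4)" using that b M0 n1 by (intro mult_left_mono) auto
    then have "b / 2 * r \<le> L" using L M0 by simp
    then have "0 \<le> r * (L - b / 2 * r)" using that by simp
    then show ?thesis by (simp add: \<phi>_def power2_eq_square algebra_simps)
  qed
  define \<Phi> where "\<Phi> z = u (fst z) - u (snd z) - \<phi> (norm (fst z - snd z)) - 4 * M * (fst z \<bullet> fst z)"
    for z :: "(real^'n) \<times> (real^'n)"
  define D where "D = {z :: (real^'n) \<times> (real^'n). norm (fst z) \<le> 1 / 2 \<and> norm (fst z - snd z) \<le> 1 / 4}"
  have D_sub: "fst z \<in> ?U" "snd z \<in> ?U" "2 *\<^sub>R fst z - snd z \<in> ?U" if "z \<in> D" for z
  proof -
    have "norm (snd z) \<le> norm (fst z) + norm (fst z - snd z)"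
      by (metis norm_triangle_sub norm_minus_commute)
    moreover have "norm (2 *\<^sub>R fst z - snd z) \<le> norm (fst z) + norm (fst z - snd z)"
      using norm_triangle_ineq[of "fst z" "fst z - snd z"] by (simp add: scaleR_2)
    ultimately show "fst z \<in> ?U" "snd z \<in> ?U" "2 *\<^sub>R fst z - snd z \<in> ?U"
      using that by (auto simp: D_def)
  qed
  have contu: "continuous_on ?U u"
    using u unfolding C_k_on_def by (metis iter_partial.simps(1) list.size(3) zero_le)
  have "compact D"
  proof -
    have "D \<subseteq> cball 0 1 \<times> cball 0 1"
      using D_sub by (force simp: less_imp_le)
    then have "bounded D" 
      using bounded_subset[OF bounded_Times[OF bounded_cball bounded_cball]] by blast
    moreover have "closed D"
      unfolding D_def by (intro closed_Collect_conj closed_Collect_le continuous_intros)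
    ultimately show ?thesis by (simp add: compact_eq_bounded_closed)
  qed
  moreover have "continuous_on D \<Phi>"
    unfolding \<Phi>_def \<phi>_def using D_sub
    by (intro continuous_intros continuous_on_compose2[OF contu]) auto
  moreover have xyD: "(x, y) \<in> D" using xy by (simp add: D_def)
  ultimately obtain w where w: "w \<in> D" "\<And>z. z \<in> D \<Longrightarrow> \<Phi> z \<le> \<Phi> w"
    using continuous_attains_sup[of D \<Phi>] by blast
  obtain X Y where XY: "w = (X, Y)" by (cases w)
  have "\<Phi> (x, y) > 0" using neg by (simp add: \<Phi>_def \<phi>_def)
  then have pos: "\<Phi> (X, Y) > 0" using w(2)[OF xyD] XY by simp
  have U: "X \<in> ?U" "Y \<in> ?U" "2 *\<^sub>R X - Y \<in> ?U" using D_sub[OF w(1)] XY by auto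
  have wD: "norm X \<le> 1 / 2" "norm (X - Y) \<le> 1 / 4" using w(1) XY by (auto simp: D_def)
  have "norm (X - Y) \<noteq> 0"
  proof
    assume "norm (X - Y) = 0"
    then have "\<Phi> (X, Y) = - (4 * M * (X \<bullet> X))" by (simp add: \<Phi>_def \<phi>_def)
    then show False using pos mult_nonneg_nonneg[OF M0 inner_ge_zero[of X]] by simp
  qed
  have pos': "\<phi> (norm (X - Y)) + 4 * M * (X \<bullet> X) < u X - u Y"
    using pos by (simp add: \<Phi>_def)
  from \<open>norm (X - Y) \<noteq> 0\<close> have rpos: "norm (X - Y) > 0" by simp
  have int1: "norm X < 1 / 2"
  proof (rule ccontr)
    assume "\<not> ?thesis"
    then have "norm X = 1 / 2" using wD by simp
    then have "X \<bullet> X = 1 / 4" by (simp only: dot_square_norm) (simp add: power2_eq_square)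
    then have "4 * M * (X \<bullet> X) = M" by simp
    moreover have "0 \<le> \<phi> (norm (X - Y))" using wD by (intro \<phi>_nonneg) auto
    ultimately show False using pos' osc[OF U(1,2)] by linarith
  qed
  have int2: "norm (X - Y) < 1 / 4"
  proof (rule ccontr)
    assume "\<not> ?thesis"
    then have "norm (X - Y) = 1 / 4" using wD by simp
    moreover have "\<phi> (1 / 4) = M"
      by (simp add: \<phi>_def L power2_eq_square add_divide_distrib)
    ultimately have "\<phi> (norm (X - Y)) = M" by (simp only:)
    moreover have "0 \<le> 4 * M * (X \<bullet> X)" using M0 by simp
    ultimately show False using pos' osc[OF U(1,2)] by linarith
  qed
  have "\<forall>\<^sub>F z in nhds (X, Y). z \<in> {z. norm (fst z) < 1 / 2 \<and> norm (fst z - snd z) < 1 / 4}"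
    using int1 int2
    by (intro eventually_nhds_in_open open_Collect_conj open_Collect_less continuous_intros) auto
  then have "\<forall>\<^sub>F z in nhds (X, Y). \<Phi> z \<le> \<Phi> (X, Y)"
    by eventually_elim (use w(2) XY in \<open>auto simp: D_def\<close>)
  then have max: "\<forall>\<^sub>F z in nhds (X, Y). u (fst z) - u (snd z)
      - (L * norm (fst z - snd z) - b / 2 * (norm (fst z - snd z))\<^sup>2) - 4 * M * (fst z \<bullet> fst z)
      \<le> u X - u Y - (L * norm (X - Y) - b / 2 * (norm (X - Y))\<^sup>2) - 4 * M * (X \<bullet> X)"
    by (simp add: \<Phi>_def \<phi>_def)
  define e where "e = (1 / norm (X - Y)) *\<^sub>R (X - Y)"
  have "norm e = 1" using rpos by (simp add: e_def)
  obtain p d where p: "eigenframe (hessian u X) p d"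
    using eigenframe_exists hessian_symmetric[OF open_ball U(1) u] by blast
  obtain q \<mu> where q: "eigenframe (hessian u Y) q \<mu>"
    using eigenframe_exists hessian_symmetric[OF open_ball U(2) u] by blast
  have psi: "(\<Sum>i\<in>UNIV. arctan (d i)) = \<psi> X" "(\<Sum>i\<in>UNIV. arctan (\<mu> i)) = \<psi> Y"
    using eq[OF U(1)] eq[OF U(2)] sum_arctan_eigenvalues[OF p] sum_arctan_eigenvalues[OF q] by simp_all
  let ?a = "2 * real CARD('n)"
  have gap: "(hessian u X *v \<xi>) \<bullet> \<xi> + (?a + 4 * (4 * M)) * t\<^sup>2 - 2 * (4 * M) * (\<xi> \<bullet> \<xi>)
        \<le> (hessian u Y *v (\<xi> + t *\<^sub>R e)) \<bullet> (\<xi> + t *\<^sub>R e)" for \<xi> t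
    using doubling_second_variation[OF open_ball U(1,2) u refl rpos e_def max] by (simp add: b)
  have a: "?a > 0" and K: "4 * M \<ge> 0" using n1 M0 by auto
  have "\<psi> X \<le> (real CARD('n) - 2) * (pi / 2) + 1 / ?a"
    using doubling_phase_gap(1)[OF p q \<open>norm e = 1\<close> a K gap] crit[OF U(1)] psi by simp
  also have "1 / ?a \<le> 1 / 2" using n1 by simp
  finally have "\<psi> X \<le> (real CARD('n) - 2) * (pi / 2) + 1 / 2" by simp
  moreover have "real CARD('n) * (pi / 2) - 1 \<le> \<psi> Y"
    using doubling_phase_gap(2)[OF p q \<open>norm e = 1\<close> a K gap] crit[OF U(1)] psi n1
    by (simp add: right_diff_distrib)
  \<comment> \<open>The point \<open>X\<close> is the midpoint of \<open>Y\<close> and its reflection, so the excess of \<open>\<psi>\<close> over the critical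
    value is at least half as large at \<open>X\<close> as at \<open>Y\<close>.\<close>
  moreover have "(\<psi> Y + \<psi> (2 *\<^sub>R X - Y)) / 2 \<le> \<psi> X"
  proof -
    have "(1 / 2) *\<^sub>R Y + (1 / 2) *\<^sub>R (2 *\<^sub>R X - Y) = X"
      by (simp add: scaleR_right_diff_distrib)
    then show ?thesis
      using conc[unfolded concave_on_iff, THEN conjunct2, rule_format, OF U(2,3), of "1 / 2" "1 / 2"]
      by simp
  qed
  moreover have "\<psi> (2 *\<^sub>R X - Y) \<ge> (real CARD('n) - 2) * (pi / 2)" by (rule crit[OF U(3)])
  ultimately have "pi \<le> 2" by (simp add: algebra_simps)
  then show False using pi_gt3 by simp
qed

lemma norm_gradient_le:
  fixes u :: "real^'n::finite \<Rightarrow> real"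
  assumes diff: "u differentiable (at 0)" and \<delta>: "\<delta> > 0"
    and le: "\<And>y. norm y \<le> \<delta> \<Longrightarrow> u 0 - u y \<le> L * norm y"
    and L: "0 \<le> L"
  shows "norm (gradient u 0) \<le> L"
proof (rule ccontr)
  assume neg: "\<not> ?thesis"
  define v where "v = (1 / norm (gradient u 0)) *\<^sub>R gradient u 0"
  have v: "norm v = 1" using neg L by (auto simp: v_def)
  have dv: "dir_deriv u (- v) 0 = - norm (gradient u 0)"
  proof -
    have "dir_deriv u (- v) 0 = - (v \<bullet> gradient u 0)"
      by (simp add: dir_deriv_def inner_vec_def gradient_def sum_negf)
    also have "v \<bullet> gradient u 0 = norm (gradient u 0)"
      using neg L by (auto simp: v_def dot_square_norm power2_eq_square)
    finally show ?thesis .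
  qed
  have "((\<lambda>s. u (0 + s *\<^sub>R (- v)) + L * s) has_real_derivative - norm (gradient u 0) + L) (at 0)"
    using diff dv[symmetric] has_real_derivative_line[of u 0 0 "- v"]
    by (auto intro!: derivative_eq_intros)
  then obtain \<eta> where \<eta>: "\<eta> > 0" "\<And>h. 0 < h \<Longrightarrow> h < \<eta> \<Longrightarrow> u (- (h *\<^sub>R v)) + L * h < u 0"
    using DERIV_neg_dec_right[of "\<lambda>s. u (0 + s *\<^sub>R (- v)) + L * s" "- norm (gradient u 0) + L" 0] neg by auto
  define h where "h = min \<eta> \<delta> / 2"
  have h: "0 < h" "h < \<eta>" "h \<le> \<delta>" using \<eta> \<delta> by (auto simp: h_def)
  show False using \<eta>(2)[OF h(1,2)] le[of "- (h *\<^sub>R v)"] h v by simp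
qed

text \<open>
  Boundedness makes the supremum and infimum in the oscillation genuine; for unbounded functions the
  real-valued operators take unspecified values.
\<close>
lemma C_k_closure_bounded:
  fixes u :: "real^'n::finite \<Rightarrow> real"
  assumes u: "C_k_closure k S u" and S: "bounded S"
  shows "bounded (u ` S)"
proof -
  obtain g where g: "continuous_on (closure S) g" "\<forall>x\<in>S. g x = u x"
    using u unfolding C_k_closure_def by (metis iter_partial.simps(1) list.size(3) zero_le)
  have "compact (g ` closure S)" using g(1) S by (intro compact_continuous_image) auto
  then have "bounded (g ` closure S)" by (rule compact_imp_bounded)
  moreover have "u ` S \<subseteq> g ` closure S" using g(2) closure_subset by force
  ultimately show ?thesis by (rule bounded_subset)
qed

lemma diff_le_osc_on:
  assumes "bounded (f ` S)" "x \<in> S" "y \<in> S"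
  shows "f x - f y \<le> osc_on S f"
  unfolding osc_on_def using assms
  by (intro diff_mono cSUP_upper cINF_lower bounded_imp_bdd_above bounded_imp_bdd_below)

theorem mainTheorem5:
  shows "\<exists>C::real. \<forall>(\<psi> :: real^'n::finite \<Rightarrow> real) (u :: real^'n \<Rightarrow> real).
    C_k_on 1 (ball 0 1) \<psi> \<longrightarrow>
    concave_on (ball 0 1) \<psi> \<longrightarrow>
    (\<forall>x\<in>ball 0 1. \<psi> x \<ge> (real CARD('n) - 2) * (pi / 2)) \<longrightarrow>
    C_k_closure 3 (ball 0 1) u \<longrightarrow>
    (\<forall>x\<in>ball 0 1. (\<Sum>l\<in>#eigenvalues (hessian u x). arctan l) = \<psi> x) \<longrightarrow>
    norm (gradient u 0) \<le> C * (1 + osc_on (ball 0 1) u)"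
proof (intro exI allI impI)
  fix \<psi> u :: "real^'n::finite \<Rightarrow> real"
  let ?U = "ball 0 1 :: (real^'n) set"
  let ?n = "real CARD('n)"
  assume conc: "concave_on ?U \<psi>" and crit: "\<forall>x\<in>?U. \<psi> x \<ge> (real CARD('n) - 2) * (pi / 2)"
    and u: "C_k_closure 3 ?U u"
    and eq: "\<forall>x\<in>?U. (\<Sum>l\<in>#eigenvalues (hessian u x). arctan l) = \<psi> x"
  have u2: "C_k_on 2 ?U u" using u by (simp add: C_k_closure_def C_k_on_def)
  define M where "M = osc_on ?U u"
  define b where "b = 2 * ?n + 16 * M"
  define L where "L = 4 * M + b / 8"
  have osc: "u x - u y \<le> M" if "x \<in> ?U" "y \<in> ?U" for x y
    unfolding M_def using C_k_closure_bounded[OF u bounded_ball] that by (rule diff_le_osc_on)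
  have M0: "M \<ge> 0" using osc[of 0 0] by simp
  have b0: "b \<ge> 0" using M0 by (simp add: b_def)
  have "norm (gradient u 0) \<le> L"
  proof (rule norm_gradient_le[where \<delta> = "1 / 4"])
    show "u differentiable (at 0)" using C_k_on_partial(1)[OF u2] by simp
    show "0 \<le> L" using M0 b0 by (simp add: L_def)
    fix y :: "real^'n" assume y: "norm y \<le> 1 / 4"
    have "u 0 - u y \<le> L * norm (0 - y) - b / 2 * (norm (0 - y))\<^sup>2 + 4 * M * ((0::real^'n) \<bullet> 0)"
      using crit eq osc y by (intro doubling_estimate[OF u2 conc _ _ _ b_def L_def]) auto
    moreover have "0 \<le> b / 2 * (norm y)\<^sup>2" using b0 by simp
    ultimately show "u 0 - u y \<le> L * norm y" by simp
  qed simp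
  also have "L = 6 * M + ?n / 4" by (simp add: L_def b_def)
  also have "\<dots> \<le> (?n + 6) * (1 + M)"
    using M0 by (simp add: algebra_simps)
  finally show "norm (gradient u 0) \<le> (?n + 6) * (1 + osc_on ?U u)" by (simp add: M_def)
qed

end
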